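(* Let $(D,G_o)$ be a two-sender unicast index-coding problem with a fully participated interaction between its sub-digraphs $D_1,D_2,D_3$. Suppose that $f(D)$ contains both arcs $(1,3)$ and $(3,1)$ and contains at most one of the arcs $(2,3)$, $(3,2)$ (with arbitrary arcs between $1$ and $2$). Then $$\beta(D,G_o)=\beta(D_2)+\max\{\beta(D_1),\beta(D_3)\}.$$
   Context: There are $N$ messages $\mathcal{M}=\{x_1,\dots,x_N\}$, $x_i\in\{0,1\}^t$, and $N$ receivers; receiver $r$ requests $x_r$ and knows $\{x_j: j\in N_D^+(r)\}$, where $D$ is a loopless digraph on $V(D)=\{1,\dots,N\}$ (the side-information digraph) and $N_D^+(r)$ is the out-neighborhood of $r$. Single sender: an index code is an encoding function of all messages into $\{0,1\}^p$ together with decoding functions by which every receiver $r$ recovers $x_r$, for all message realizations, from the codeword and its side information. $\beta_t(D)$ is the minimum of $p/t$ over index codes for $t$-bit messages, and $\beta(D)=\inf_t\beta_t(D)=\lim_{t\to\infty}\beta_t(D)$. (The empty digraph has rate $0$.) Two senders: senders $S_1,S_2$ know $\mathcal{M}_1,\mathcal{M}_2$ with $\mathcal{M}_1\cup\mathcal{M}_2=\mathcal{M}$. A two-sender index code consists of encoding functions $\mathscr{F}_s:\{0,1\}^{|\mathcal{M}_s|t}\to\{0,1\}^{p_s}$, $s=1,2$ ($p_s\ge0$ an integer), and decoding functions by which every receiver $r$ recovers $x_r$, for all message realizations, from both sub-codewords and its side information. $\beta_t(D,G_o)$ is the minimum of $(p_1+p_2)/t$ over two-sender index codes for $t$-bit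 messages, and $\beta(D,G_o)=\inf_t\beta_t(D,G_o)=\lim_{t\to\infty}\beta_t(D,G_o)$. Here $G_o$ (the sender-constraint graph, with vertex set $V(D)$ and an edge $ij$ iff one of $x_i,x_j$ is in $\mathcal{M}_1\setminus\mathcal{M}_2$ and the other in $\mathcal{M}_2\setminus\mathcal{M}_1$) records the senders' message sets. Let $\mathcal{P}_1=\mathcal{M}_1\setminus\mathcal{M}_2$, $\mathcal{P}_2=\mathcal{M}_2\setminus\mathcal{M}_1$, $\mathcal{P}_3=\mathcal{M}_1\cap\mathcal{M}_2$. For $i\in\{1,2,3\}$, $D_i$ is the sub-digraph of $D$ induced by $\{j:x_j\in\mathcal{P}_i\}$. The digraph $f(D)$ has vertex set $\{1,2,3\}$, and $(i,j)$, $i\neq j$, is an arc of $f(D)$ iff there is an arc of $D$ from some vertex of $D_i$ to some vertex of $D_j$. The interaction is fully participated if, whenever $(i,j)$ is an arc of $f(D)$, every vertex of $D_i$ has arcs to all vertices of $D_j$. *)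

theory Defs
  imports Complex_Main "HOL-Library.FuncSet" "Graph_Theory.Graph_Theory"
begin

definition bits :: "nat \<Rightarrow> bool list set" where
  "bits n = {w. length w = n}"

text \<open>Realizations of the \<open>t\<close>-bit messages indexed by \<open>A\<close>; this set stands for
  the words of length \<open>|A| * t\<close>, without fixing an order on \<open>A\<close>.\<close>

definition msgs :: "nat \<Rightarrow> 'a set \<Rightarrow> ('a \<Rightarrow> bool list) set" where
  "msgs t A = (\<Pi>\<^sub>E j\<in>A. bits t)"

definition out_nbrs :: "('a, 'b) pre_digraph \<Rightarrow> 'a \<Rightarrow> 'a set" where
  "out_nbrs D r = {j. r \<rightarrow>\<^bsub>D\<^esub> j}"

definition index_code ::
  "('a, 'b) pre_digraph \<Rightarrow> nat \<Rightarrow> nat \<Rightarrow> (('a \<Rightarrow> bool list) \<Rightarrow> bool list)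
    \<Rightarrow> ('a \<Rightarrow> bool list \<Rightarrow> ('a \<Rightarrow> bool list) \<Rightarrow> bool list) \<Rightarrow> bool" where
  "index_code D t p enc dec \<longleftrightarrow>
     enc \<in> msgs t (verts D) \<rightarrow> bits p \<and>
     (\<forall>r\<in>verts D. dec r \<in> bits p \<rightarrow> msgs t (out_nbrs D r) \<rightarrow> bits t) \<and>
     (\<forall>x\<in>msgs t (verts D). \<forall>r\<in>verts D.
        dec r (enc x) (restrict x (out_nbrs D r)) = x r)"

text \<open>For a finite digraph the minimum exists, since sending all messages uncoded is an
  index code.\<close>

definition broadcast_rate_t :: "nat \<Rightarrow> ('a, 'b) pre_digraph \<Rightarrow> real" (\<open>\<beta>\<^bsub>_\<^esub>\<close>) where
  "\<beta>\<^bsub>t\<^esub> D = real (LEAST p. \<exists>enc dec. index_code D t p enc dec) / real t"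

definition broadcast_rate :: "('a, 'b) pre_digraph \<Rightarrow> real" (\<open>\<beta>\<close>) where
  "\<beta> D = (INF t\<in>{1..}. \<beta>\<^bsub>t\<^esub> D)"

text \<open>Sender \<open>s\<close> holds the messages whose indices lie in \<open>M\<^sub>s\<close>. The pair \<open>M1\<close>, \<open>M2\<close>
  takes the place of the sender-constraint graph, whose edges are the pairs with one
  endpoint in \<open>M1 - M2\<close> and the other in \<open>M2 - M1\<close>.\<close>

definition two_sender_index_code ::
  "('a, 'b) pre_digraph \<Rightarrow> 'a set \<Rightarrow> 'a set \<Rightarrow> nat \<Rightarrow> nat \<Rightarrow> nat
    \<Rightarrow> (('a \<Rightarrow> bool list) \<Rightarrow> bool list) \<Rightarrow> (('a \<Rightarrow> bool list) \<Rightarrow> bool list)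
    \<Rightarrow> ('a \<Rightarrow> bool list \<Rightarrow> bool list \<Rightarrow> ('a \<Rightarrow> bool list) \<Rightarrow> bool list) \<Rightarrow> bool" where
  "two_sender_index_code D M1 M2 t p1 p2 enc1 enc2 dec \<longleftrightarrow>
     enc1 \<in> msgs t M1 \<rightarrow> bits p1 \<and>
     enc2 \<in> msgs t M2 \<rightarrow> bits p2 \<and>
     (\<forall>r\<in>verts D. dec r \<in> bits p1 \<rightarrow> bits p2 \<rightarrow> msgs t (out_nbrs D r) \<rightarrow> bits t) \<and>
     (\<forall>x\<in>msgs t (verts D). \<forall>r\<in>verts D.
        dec r (enc1 (restrict x M1)) (enc2 (restrict x M2)) (restrict x (out_nbrs D r)) = x r)"

definition two_sender_rate_t ::
  "nat \<Rightarrow> ('a, 'b) pre_digraph \<Rightarrow> 'a set \<Rightarrow> 'a set \<Rightarrow> real" where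
  "two_sender_rate_t t D M1 M2 =
     real (LEAST p. \<exists>p1 p2 enc1 enc2 dec.
       p = p1 + p2 \<and> two_sender_index_code D M1 M2 t p1 p2 enc1 enc2 dec) / real t"

definition two_sender_rate :: "('a, 'b) pre_digraph \<Rightarrow> 'a set \<Rightarrow> 'a set \<Rightarrow> real" where
  "two_sender_rate D M1 M2 = (INF t\<in>{1..}. two_sender_rate_t t D M1 M2)"

text \<open>Only the indices 1, 2 and 3 are meaningful.\<close>

definition msg_part :: "'a set \<Rightarrow> 'a set \<Rightarrow> nat \<Rightarrow> 'a set" where
  "msg_part M1 M2 i = (if i = 1 then M1 - M2 else if i = 2 then M2 - M1 else M1 \<inter> M2)"

definition sub_digraph ::
  "('a, 'b) pre_digraph \<Rightarrow> 'a set \<Rightarrow> 'a set \<Rightarrow> nat \<Rightarrow> ('a, 'b) pre_digraph" where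
  "sub_digraph D M1 M2 i = D \<restriction> msg_part M1 M2 i"

definition interaction_digraph ::
  "('a, 'b) pre_digraph \<Rightarrow> 'a set \<Rightarrow> 'a set \<Rightarrow> nat pair_pre_digraph" where
  "interaction_digraph D M1 M2 =
     \<lparr> pverts = {1, 2, 3},
       parcs = {(i, j). i \<in> {1, 2, 3} \<and> j \<in> {1, 2, 3} \<and> i \<noteq> j \<and>
         (\<exists>u\<in>verts (sub_digraph D M1 M2 i). \<exists>v\<in>verts (sub_digraph D M1 M2 j). u \<rightarrow>\<^bsub>D\<^esub> v)} \<rparr>"

definition fully_participated ::
  "('a, 'b) pre_digraph \<Rightarrow> 'a set \<Rightarrow> 'a set \<Rightarrow> bool" where
  "fully_participated D M1 M2 \<longleftrightarrow>
     (\<forall>(i, j) \<in> parcs (interaction_digraph D M1 M2).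
        \<forall>u\<in>verts (sub_digraph D M1 M2 i). \<forall>v\<in>verts (sub_digraph D M1 M2 j). u \<rightarrow>\<^bsub>D\<^esub> v)"

end

(*
  Upper bound: sender 2 sends an index code for D2, and sender 1 sends the bitwise xor of
  index codes for D1 and D3. Receivers in D1 know all messages of D3 and vice versa, so each
  of them can cancel the part of the xor that it does not need.

  Lower bound: fixing the common messages, the sub-codewords of the two senders have to be
  index codes for D1 and D2 separately, so beta(D1) + beta(D2) is a lower bound. Fixing
  the messages of P1 instead, the pair of sub-codewords is an index code for D2 and D3 together,
  with arcs between them in at most one direction, say no arc from A to B. For each message x
  of A the codewords compatible with x number at least 2^(t beta(B)), and for confusable x
  these sets are disjoint: they form a fractional colouring of the confusion graph of A. The
  broadcast rate is the limit of the logarithm of the fractional chromatic number, whence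
  beta(A) + beta(B) is a lower bound.
*)

theory Submission
  imports Defs
begin

subsection \<open>Index codes as colourings of the confusion graph\<close>

lemma finite_bits: "finite (bits n)" and card_bits: "card (bits n) = 2 ^ n"
proof -
  have "bits n = {w :: bool list. set w \<subseteq> UNIV \<and> length w = n}"
    by (simp add: bits_def)
  then show "finite (bits n)" "card (bits n) = 2 ^ n"
    using finite_lists_length_eq[of "UNIV :: bool set" n]
      card_lists_length_eq[of "UNIV :: bool set" n]
    by (simp_all add: card_UNIV_bool)
qed

lemma finite_msgs: "finite A \<Longrightarrow> finite (msgs t A)"
  by (simp add: msgs_def finite_PiE finite_bits)

lemma card_msgs: "finite A \<Longrightarrow> card (msgs t A) = 2 ^ (t * card A)"
  by (simp add: msgs_def card_PiE card_bits power_mult)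

lemma restrict_in_msgs: "x \<in> msgs t A \<Longrightarrow> B \<subseteq> A \<Longrightarrow> restrict x B \<in> msgs t B"
  by (auto simp: msgs_def PiE_iff)

lemma msgs_nonempty: "msgs t A \<noteq> {}"
proof -
  have "replicate t False \<in> bits t" by (simp add: bits_def)
  then show ?thesis by (auto simp: msgs_def PiE_eq_empty_iff)
qed

lemma restrict_eq_iff: "restrict x A = restrict y A \<longleftrightarrow> (\<forall>j\<in>A. x j = y j)"
  by (auto simp: fun_eq_iff restrict_def)

text \<open>Adjacency in the confusion graph: such a pair must never get the same codeword.\<close>

definition confusable :: "('a, 'b) pre_digraph \<Rightarrow> ('a \<Rightarrow> bool list) \<Rightarrow> ('a \<Rightarrow> bool list) \<Rightarrow> bool" where
  "confusable D x y \<longleftrightarrow> (\<exists>r\<in>verts D. x r \<noteq> y r \<and> (\<forall>j\<in>out_nbrs D r. x j = y j))"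

text \<open>Colours have an arbitrary type, so pairs of sub-codewords, tuples over blocks and
  messages themselves can serve as codewords.\<close>

definition proper_colouring :: "('a, 'b) pre_digraph \<Rightarrow> nat \<Rightarrow> (('a \<Rightarrow> bool list) \<Rightarrow> 'c) \<Rightarrow> bool" where
  "proper_colouring D t c \<longleftrightarrow>
     (\<forall>x\<in>msgs t (verts D). \<forall>y\<in>msgs t (verts D). confusable D x y \<longrightarrow> c x \<noteq> c y)"

lemma out_nbrs_induce: "r \<in> P \<Longrightarrow> out_nbrs (D \<restriction> P) r = out_nbrs D r \<inter> P"
  by (auto simp: out_nbrs_def arcs_ends_def arc_to_ends_def image_iff)

text \<open>A receiver may decode by taking any realization consistent with its codeword and side
  information; properness forces all of them to agree on the requested message. The decoder maps
  everything into \<open>bits t\<close>, so it meets the typing conditions of one-sender and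
  two-sender codes alike.\<close>

lemma proper_colouring_iff_decodable:
  "proper_colouring D t c \<longleftrightarrow>
     (\<exists>dec. (\<forall>r w s. dec r w s \<in> bits t) \<and>
        (\<forall>x\<in>msgs t (verts D). \<forall>r\<in>verts D. dec r (c x) (restrict x (out_nbrs D r)) = x r))"
    (is "_ \<longleftrightarrow> ?R")
proof
  assume proper: "proper_colouring D t c"
  define V where "V = verts D"
  define good where "good r w s x \<longleftrightarrow> x \<in> msgs t V \<and> r \<in> V \<and> c x = w \<and> restrict x (out_nbrs D r) = s"
    for r w s x
  define dec where "dec r w s =
      (if \<exists>x. good r w s x then (SOME x. good r w s x) r else replicate t False)" for r w s
  have "dec r w s \<in> bits t" for r w s
  proof (cases "\<exists>x. good r w s x")
    case True
    then have "good r w s (SOME x. good r w s x)" by (rule someI_ex)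
    then have "(SOME x. good r w s x) r \<in> bits t" unfolding good_def msgs_def by blast
    then show ?thesis using True by (simp add: dec_def)
  next
    case False
    then show ?thesis by (simp add: dec_def bits_def)
  qed
  moreover have "dec r (c x) (restrict x (out_nbrs D r)) = x r"
    if "x \<in> msgs t V" "r \<in> V" for x r
  proof -
    let ?g = "good r (c x) (restrict x (out_nbrs D r))"
    have ex: "?g x" using that by (simp add: good_def)
    define y where "y = (SOME y. ?g y)"
    have g: "?g y" unfolding y_def using ex by (rule someI[where P = ?g])
    then have "\<not> confusable D y x"
      using proper that(1) by (auto simp: good_def proper_colouring_def V_def)
    then have "y r = x r"
      using g that unfolding confusable_def good_def restrict_eq_iff V_def by blast
    moreover have "dec r (c x) (restrict x (out_nbrs D r)) = y r"
      unfolding dec_def y_def using ex by (intro if_P) blast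
    ultimately show ?thesis by simp
  qed
  ultimately show ?R unfolding V_def by blast
next
  assume ?R
  then obtain dec where dec:
    "\<And>x r. x \<in> msgs t (verts D) \<Longrightarrow> r \<in> verts D \<Longrightarrow> dec r (c x) (restrict x (out_nbrs D r)) = x r"
    by blast
  have "c x \<noteq> c y"
    if xy: "x \<in> msgs t (verts D)" "y \<in> msgs t (verts D)" "confusable D x y" for x y
  proof
    assume "c x = c y"
    obtain r where r: "r \<in> verts D" "x r \<noteq> y r" "restrict x (out_nbrs D r) = restrict y (out_nbrs D r)"
      using xy(3) by (auto simp: confusable_def restrict_eq_iff)
    then show False using dec[OF xy(1) r(1)] dec[OF xy(2) r(1)] \<open>c x = c y\<close> by simp
  qed
  then show "proper_colouring D t c" by (simp add: proper_colouring_def)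
qed

lemma ex_index_code_iff:
  "(\<exists>enc dec. index_code D t p enc dec) \<longleftrightarrow>
     (\<exists>c \<in> msgs t (verts D) \<rightarrow> bits p. proper_colouring D t c)"
proof
  assume "\<exists>enc dec. index_code D t p enc dec"
  then obtain enc dec where ed: "index_code D t p enc dec" by blast
  \<comment> \<open>The decoder of a code is typed on legal inputs only, so other outputs are
    replaced by a default.\<close>
  define dec' where "dec' r w s = (if dec r w s \<in> bits t then dec r w s else replicate t False)"
    for r w s
  have "dec' r (enc x) (restrict x (out_nbrs D r)) = x r"
    if "x \<in> msgs t (verts D)" "r \<in> verts D" for x r
    using ed that by (auto simp: index_code_def dec'_def bits_def msgs_def PiE_iff)
  moreover have "dec' r w s \<in> bits t" for r w s by (auto simp: dec'_def bits_def)
  ultimately have "proper_colouring D t enc" unfolding proper_colouring_iff_decodable by blast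
  then show "\<exists>c \<in> msgs t (verts D) \<rightarrow> bits p. proper_colouring D t c"
    using ed by (auto simp: index_code_def)
next
  assume "\<exists>c \<in> msgs t (verts D) \<rightarrow> bits p. proper_colouring D t c"
  then obtain c where c: "c \<in> msgs t (verts D) \<rightarrow> bits p" "proper_colouring D t c" by blast
  then obtain dec where "\<forall>r w s. dec r w s \<in> bits t"
    "\<forall>x\<in>msgs t (verts D). \<forall>r\<in>verts D. dec r (c x) (restrict x (out_nbrs D r)) = x r"
    unfolding proper_colouring_iff_decodable by blast
  then have "index_code D t p c dec" using c by (simp add: index_code_def)
  then show "\<exists>enc dec. index_code D t p enc dec" by blast
qed

text \<open>The pair of sub-codewords acts as a single colour; the two senders survive only in the
  requirement that each component depends on the messages of its sender.\<close>

lemma ex_two_sender_index_code_iff: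
  assumes "M1 \<subseteq> verts D" "M2 \<subseteq> verts D"
  shows "(\<exists>enc1 enc2 dec. two_sender_index_code D M1 M2 t p1 p2 enc1 enc2 dec) \<longleftrightarrow>
     (\<exists>c1 \<in> msgs t M1 \<rightarrow> bits p1. \<exists>c2 \<in> msgs t M2 \<rightarrow> bits p2.
        proper_colouring D t (\<lambda>x. (c1 (restrict x M1), c2 (restrict x M2))))"
proof
  assume "\<exists>enc1 enc2 dec. two_sender_index_code D M1 M2 t p1 p2 enc1 enc2 dec"
  then obtain enc1 enc2 dec where ed: "two_sender_index_code D M1 M2 t p1 p2 enc1 enc2 dec" by blast
  define dec' where "dec' r w s = (if dec r (fst w) (snd w) s \<in> bits t
      then dec r (fst w) (snd w) s else replicate t False)" for r w s
  have "dec' r (enc1 (restrict x M1), enc2 (restrict x M2)) (restrict x (out_nbrs D r)) = x r"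
    if "x \<in> msgs t (verts D)" "r \<in> verts D" for x r
    using ed that by (auto simp: two_sender_index_code_def dec'_def bits_def msgs_def PiE_iff)
  moreover have "dec' r w s \<in> bits t" for r w s by (auto simp: dec'_def bits_def)
  ultimately have "proper_colouring D t (\<lambda>x. (enc1 (restrict x M1), enc2 (restrict x M2)))"
    unfolding proper_colouring_iff_decodable by blast
  then show "\<exists>c1 \<in> msgs t M1 \<rightarrow> bits p1. \<exists>c2 \<in> msgs t M2 \<rightarrow> bits p2.
        proper_colouring D t (\<lambda>x. (c1 (restrict x M1), c2 (restrict x M2)))"
    using ed unfolding two_sender_index_code_def by blast
next
  assume "\<exists>c1 \<in> msgs t M1 \<rightarrow> bits p1. \<exists>c2 \<in> msgs t M2 \<rightarrow> bits p2.
        proper_colouring D t (\<lambda>x. (c1 (restrict x M1), c2 (restrict x M2)))"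
  then obtain c1 c2 where c: "c1 \<in> msgs t M1 \<rightarrow> bits p1" "c2 \<in> msgs t M2 \<rightarrow> bits p2"
    and p: "proper_colouring D t (\<lambda>x. (c1 (restrict x M1), c2 (restrict x M2)))"
    by blast
  from p obtain dec where "\<forall>r w s. dec r w s \<in> bits t"
    "\<forall>x\<in>msgs t (verts D). \<forall>r\<in>verts D.
       dec r (c1 (restrict x M1), c2 (restrict x M2)) (restrict x (out_nbrs D r)) = x r"
    unfolding proper_colouring_iff_decodable by blast
  then have "two_sender_index_code D M1 M2 t p1 p2 c1 c2 (\<lambda>r w1 w2. dec r (w1, w2))"
    using c by (simp add: two_sender_index_code_def)
  then show "\<exists>enc1 enc2 dec. two_sender_index_code D M1 M2 t p1 p2 enc1 enc2 dec" by blast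
qed

text \<open>Injective recolouring preserves properness, so only the number of colours used matters
  for the code length.\<close>

lemma ex_index_code_of_colouring:
  assumes "finite (verts D)" "proper_colouring D t c" "card (c ` msgs t (verts D)) \<le> 2 ^ p"
  shows "\<exists>enc dec. index_code D t p enc dec"
proof -
  have "finite (c ` msgs t (verts D))" using assms(1) finite_msgs by blast
  moreover have "card (c ` msgs t (verts D)) \<le> card (bits p)" using assms(3) by (simp add: card_bits)
  ultimately obtain g where g: "g ` c ` msgs t (verts D) \<subseteq> bits p" "inj_on g (c ` msgs t (verts D))"
    using card_le_inj[OF _ finite_bits] by blast
  have "g \<circ> c \<in> msgs t (verts D) \<rightarrow> bits p" using g(1) by auto
  moreover have "proper_colouring D t (g \<circ> c)"
    using assms(2) g(2) unfolding proper_colouring_def comp_def by (metis imageI inj_onD)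
  ultimately show ?thesis unfolding ex_index_code_iff by blast
qed

lemma proper_colouring_id: "proper_colouring D t (\<lambda>x. x)"
  by (auto simp: proper_colouring_def confusable_def)

lemma ex_index_code:
  assumes "finite (verts D)"
  shows "\<exists>p enc dec. index_code D t p enc dec"
proof -
  have "card ((\<lambda>x. x) ` msgs t (verts D)) \<le> 2 ^ (t * card (verts D))"
    using assms by (simp add: card_msgs)
  then show ?thesis using ex_index_code_of_colouring[OF assms proper_colouring_id] by blast
qed

section \<open>Single-sender rates in terms of colourings\<close>

lemma broadcast_rate_t_attained:
  assumes "finite (verts D)" "t \<ge> 1"
  obtains p c where "\<beta>\<^bsub>t\<^esub> D = real p / real t"
    "c \<in> msgs t (verts D) \<rightarrow> bits p" "proper_colouring D t c"
proof -
  let ?p = "LEAST p. \<exists>enc dec. index_code D t p enc dec"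
  have "\<exists>enc dec. index_code D t ?p enc dec"
    by (rule LeastI_ex) (rule ex_index_code[OF assms(1)])
  then obtain c where c: "c \<in> msgs t (verts D) \<rightarrow> bits ?p" "proper_colouring D t c"
    unfolding ex_index_code_iff by blast
  show ?thesis by (rule that[OF broadcast_rate_t_def c])
qed

lemma broadcast_rate_t_le:
  assumes "finite (verts D)" "proper_colouring D t c" "card (c ` msgs t (verts D)) \<le> 2 ^ p"
  shows "\<beta>\<^bsub>t\<^esub> D \<le> real p / real t"
  unfolding broadcast_rate_t_def
  by (intro divide_right_mono of_nat_mono Least_le ex_index_code_of_colouring[OF assms]) auto

lemma broadcast_rate_le: "t \<ge> 1 \<Longrightarrow> \<beta> D \<le> \<beta>\<^bsub>t\<^esub> D"
  unfolding broadcast_rate_def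
  by (intro cINF_lower bdd_belowI[of _ 0]) (auto simp: broadcast_rate_t_def)

lemma broadcast_rate_approx:
  assumes "e > 0"
  obtains t where "t \<ge> 1" "\<beta>\<^bsub>t\<^esub> D < \<beta> D + e"
proof -
  have "bdd_below ((\<lambda>t. \<beta>\<^bsub>t\<^esub> D) ` {1..})"
    by (intro bdd_belowI[of _ 0]) (auto simp: broadcast_rate_t_def)
  then have "\<exists>t\<in>{1..}. \<beta>\<^bsub>t\<^esub> D < \<beta> D + e"
    using assms cINF_less_iff[of "{1..}" "\<lambda>t. \<beta>\<^bsub>t\<^esub> D" "\<beta> D + e"]
    unfolding broadcast_rate_def by auto
  then show ?thesis using that by auto
qed

subsection \<open>Message blocks and fractional colourings\<close>

text \<open>Cuts every message into consecutive pieces of \<open>t\<close> bits; the restriction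
  keeps each block extensional, as \<open>msgs\<close> demands.\<close>

definition block :: "'a set \<Rightarrow> nat \<Rightarrow> ('a \<Rightarrow> bool list) \<Rightarrow> nat \<Rightarrow> 'a \<Rightarrow> bool list" where
  "block A t x i = restrict (\<lambda>j. take t (drop (i * t) (x j))) A"

lemma block_in_msgs:
  assumes "x \<in> msgs (k * t) A" "i < k"
  shows "block A t x i \<in> msgs t A"
proof -
  have "t \<le> k * t - i * t"
    using mult_le_mono1[of "Suc i" k t] assms(2) by simp
  then show ?thesis using assms by (auto simp: block_def msgs_def bits_def PiE_iff)
qed

lemma eq_if_blocks_eq:
  fixes xs ys :: "'c list"
  assumes "length xs = k * t" "length ys = k * t"
    "\<And>i. i < k \<Longrightarrow> take t (drop (i * t) xs) = take t (drop (i * t) ys)"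
  shows "xs = ys"
proof (rule nth_equalityI)
  fix n assume n: "n < length xs"
  \<comment> \<open>Blocks of length 0 would leave the lists without a position
    \<open>n\<close>.\<close>
  then have t: "t > 0" using assms by (cases t) auto
  define i where "i = n div t"
  have i: "i < k" using n assms(1) t by (simp add: i_def less_mult_imp_div_less)
  have m: "n mod t < t" using t by simp
  have le: "i * t \<le> length xs" "i * t \<le> length ys" using i assms by auto
  have "take t (drop (i * t) zs) ! (n mod t) = zs ! n" if "i * t \<le> length zs" for zs :: "'c list"
    using m that by (simp add: i_def)
  from this[of xs] this[of ys] assms(3)[OF i] le show "xs ! n = ys ! n" by simp
qed (use assms in auto)

text \<open>Two different requested messages differ in some block, while agreement of the side
  information passes to every block.\<close>

lemma confusable_block:
  assumes "x \<in> msgs (k * t) (verts D)" "y \<in> msgs (k * t) (verts D)"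
    "confusable D x y"
  obtains i where "i < k" "confusable D (block (verts D) t x i) (block (verts D) t y i)"
proof -
  obtain r where r: "r \<in> verts D" "x r \<noteq> y r" "\<forall>j\<in>out_nbrs D r. x j = y j"
    using assms(3) by (auto simp: confusable_def)
  have "length (x r) = k * t" "length (y r) = k * t"
    using assms(1,2) r(1) by (auto simp: msgs_def bits_def PiE_iff)
  then obtain i where "i < k" "take t (drop (i * t) (x r)) \<noteq> take t (drop (i * t) (y r))"
    using eq_if_blocks_eq r(2) by blast
  moreover from this have "confusable D (block (verts D) t x i) (block (verts D) t y i)"
    using r by (auto simp: confusable_def block_def)
  ultimately show ?thesis using that by blast
qed

text \<open>Coding each block separately multiplies the message length and the codeword length by
  the same \<open>k\<close>. This later brings codes for different message lengths to a common
  one.\<close>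

lemma broadcast_rate_t_mult_le:
  assumes "finite (verts D)" "t \<ge> 1" "k \<ge> 1"
  shows "\<beta>\<^bsub>k * t\<^esub> D \<le> \<beta>\<^bsub>t\<^esub> D"
proof -
  let ?V = "verts D"
  obtain p c where p: "\<beta>\<^bsub>t\<^esub> D = real p / real t" and c: "c \<in> msgs t ?V \<rightarrow> bits p"
    and proper: "proper_colouring D t c"
    using broadcast_rate_t_attained[OF assms(1,2)] by metis
  define C where "C x = (\<lambda>i\<in>{..<k}. c (block ?V t x i))" for x
  have sub: "C ` msgs (k * t) ?V \<subseteq> (\<Pi>\<^sub>E i\<in>{..<k}. bits p)"
  proof (rule image_subsetI)
    fix x assume "x \<in> msgs (k * t) ?V"
    then have "c (block ?V t x i) \<in> bits p" if "i < k" for i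
      using c block_in_msgs that by blast
    then show "C x \<in> (\<Pi>\<^sub>E i\<in>{..<k}. bits p)" by (simp add: C_def)
  qed
  have "card (C ` msgs (k * t) ?V) \<le> card (\<Pi>\<^sub>E i\<in>{..<k}. bits p)"
    by (intro card_mono[OF _ sub] finite_PiE) (auto simp: finite_bits)
  also have "\<dots> = 2 ^ (p * k)" by (simp add: card_PiE card_bits power_mult)
  finally have "card (C ` msgs (k * t) ?V) \<le> 2 ^ (p * k)" .
  moreover have "proper_colouring D (k * t) C"
    unfolding proper_colouring_def
  proof (intro ballI impI)
    fix x y assume xy: "x \<in> msgs (k * t) ?V" "y \<in> msgs (k * t) ?V" "confusable D x y"
    then obtain i where i: "i < k" "confusable D (block ?V t x i) (block ?V t y i)"
      using confusable_block by metis
    then have "c (block ?V t x i) \<noteq> c (block ?V t y i)"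
      using proper block_in_msgs xy unfolding proper_colouring_def by metis
    then have "C x i \<noteq> C y i" using i(1) by (simp add: C_def)
    then show "C x \<noteq> C y" by metis
  qed
  ultimately have "\<beta>\<^bsub>k * t\<^esub> D \<le> real (p * k) / real (k * t)"
    by (intro broadcast_rate_t_le assms(1))
  also have "\<dots> = \<beta>\<^bsub>t\<^esub> D" using assms(3) by (simp add: p)
  finally show ?thesis .
qed

section \<open>Greedy covering and rounding of fractional colourings\<close>

text \<open>Each round adds a point of \<open>C\<close> that hits many of the sets not yet hit. On
  average a point lies in a fraction of at least \<open>K / card C\<close> of them, so the number
  missed shrinks by the complementary factor.\<close>

lemma greedy_cover:
  fixes S :: "'x \<Rightarrow> 'c set"
  assumes "finite X" "finite C" "C \<noteq> {}" "K \<ge> 0"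
    and S: "\<And>x. x \<in> X \<Longrightarrow> S x \<subseteq> C" "\<And>x. x \<in> X \<Longrightarrow> K \<le> real (card (S x))"
  shows "\<exists>F\<subseteq>C. card F \<le> L \<and>
    real (card {x\<in>X. S x \<inter> F = {}}) \<le> real (card X) * (1 - K / real (card C)) ^ L"
proof (induction L)
  case 0
  show ?case by (intro exI[of _ "{}"]) auto
next
  case (Suc L)
  then obtain F where F: "F \<subseteq> C" "card F \<le> L"
    "real (card {x\<in>X. S x \<inter> F = {}}) \<le> real (card X) * (1 - K / real (card C)) ^ L"
    by blast
  define Y where "Y = {x\<in>X. S x \<inter> F = {}}"
  have finY: "finite Y" using assms(1) by (simp add: Y_def)
  have cardC: "real (card C) > 0" using assms(2,3) by (simp add: card_gt_0_iff)
  have SC: "{c \<in> C. c \<in> S x} = S x" if "x \<in> Y" for x using that S(1) by (auto simp: Y_def)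
  \<comment> \<open>Double counting of the pairs of a point and an unhit set containing it.\<close>
  have "(\<Sum>c\<in>C. card {x\<in>Y. c \<in> S x}) = (\<Sum>x\<in>Y. card (S x))"
    using SC by (intro sum_multicount_gen[OF assms(2) finY]) auto
  then have "(\<Sum>c\<in>C. real (card {x\<in>Y. c \<in> S x})) = (\<Sum>x\<in>Y. real (card (S x)))"
    by (simp flip: of_nat_sum)
  also have "\<dots> \<ge> (\<Sum>x\<in>Y. K)" by (intro sum_mono S(2)) (simp add: Y_def)
  finally have ge: "(\<Sum>c\<in>C. real (card {x\<in>Y. c \<in> S x})) \<ge> K * real (card Y)"
    by (simp add: mult.commute)
  obtain c where c: "c \<in> C" "real (card {x\<in>Y. c \<in> S x}) \<ge> K * real (card Y) / real (card C)"
  proof (rule ccontr)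
    assume "\<not> thesis"
    then have "\<And>c. c \<in> C \<Longrightarrow> real (card {x\<in>Y. c \<in> S x}) < K * real (card Y) / real (card C)"
      using that by force
    then have "(\<Sum>c\<in>C. real (card {x\<in>Y. c \<in> S x})) < (\<Sum>c\<in>C. K * real (card Y) / real (card C))"
      using assms(2,3) by (intro sum_strict_mono) auto
    also have "\<dots> = K * real (card Y)" using cardC by simp
    finally show False using ge by simp
  qed
  have KC: "K / real (card C) \<le> 1" if "x \<in> X" for x
  proof -
    have "K \<le> real (card C)"
      using S(2)[OF that] card_mono[OF assms(2) S(1)[OF that]] by simp
    then show ?thesis using cardC by simp
  qed
  let ?Z = "{x\<in>X. S x \<inter> insert c F = {}}"
  have Z: "?Z = Y - {x\<in>Y. c \<in> S x}" by (auto simp: Y_def)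
  have "real (card ?Z) = real (card Y) - real (card {x\<in>Y. c \<in> S x})"
    unfolding Z using finY by (subst card_Diff_subset) (auto intro!: of_nat_diff card_mono)
  also have "\<dots> \<le> real (card Y) * (1 - K / real (card C))"
    using c(2) by (simp add: algebra_simps)
  also have "\<dots> \<le> real (card X) * (1 - K / real (card C)) ^ Suc L"
  \<comment> \<open>For empty \<open>X\<close> nothing bounds \<open>K\<close> by
    \<open>card C\<close>, so the factor could be negative; then both sides are 0.\<close>
  proof (cases "X = {}")
    case True
    then show ?thesis by (simp add: Y_def)
  next
    case False
    then have "0 \<le> 1 - K / real (card C)" using KC by force
    then show ?thesis
      using mult_right_mono[OF F(3), of "1 - K / real (card C)"] by (simp add: Y_def mult_ac)
  qed
  finally have "real (card ?Z) \<le> real (card X) * (1 - K / real (card C)) ^ Suc L" .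
  moreover have "card (insert c F) \<le> Suc L"
    using F(1,2) assms(2) by (metis Suc_le_mono card_insert_le_m1 card_insert_if finite_subset le_SucI)
  ultimately show ?case using F(1) c(1) by (intro exI[of _ "insert c F"]) auto
qed

text \<open>Since \<open>(1 - q) ^ L\<close> is at most \<open>exp (- q * L)\<close>, slightly more
  than \<open>ln (card X) / q\<close> greedy rounds push the number of sets missed below 1, hence to
  0.\<close>

lemma ex_small_hitting_set:
  fixes S :: "'x \<Rightarrow> 'c set"
  assumes "finite X" "X \<noteq> {}" "finite C" "K > 0"
    and S: "\<And>x. x \<in> X \<Longrightarrow> S x \<subseteq> C" "\<And>x. x \<in> X \<Longrightarrow> K \<le> real (card (S x))"
  shows "\<exists>F\<subseteq>C. (\<forall>x\<in>X. S x \<inter> F \<noteq> {}) \<and>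
    real (card F) \<le> ln (real (card X)) * (real (card C) / K) + 1"
proof -
  obtain x where x: "x \<in> X" using assms(2) by blast
  have "card (S x) > 0" using S(2)[OF x] assms(4) by linarith
  then have "C \<noteq> {}" using S(1)[OF x] by force
  then have C: "real (card C) > 0" using assms(3) by (simp add: card_gt_0_iff)
  have X: "real (card X) \<ge> 1" using assms(1,2) by (simp add: Suc_leI card_gt_0_iff)
  define q where "q = K / real (card C)"
  define a where "a = ln (real (card X)) / q"
  have q: "q > 0" using assms(4) C by (simp add: q_def)
  have a: "a \<ge> 0" using X q by (simp add: a_def)
  have "K \<le> real (card C)"
    using S(2)[OF x] card_mono[OF assms(3) S(1)[OF x]] by simp
  then have q1: "q \<le> 1" using C by (simp add: q_def)
  \<comment> \<open>Rounding down and adding 1 makes \<open>L\<close> exceed \<open>a\<close>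
    strictly, as the strict bound below 1 requires.\<close>
  define L where "L = nat \<lfloor>a\<rfloor> + 1"
  have La: "real L > a" "real L \<le> a + 1" using a unfolding L_def by linarith+
  obtain F where F: "F \<subseteq> C" "card F \<le> L"
    "real (card {x\<in>X. S x \<inter> F = {}}) \<le> real (card X) * (1 - q) ^ L"
    using greedy_cover[OF assms(1,3) \<open>C \<noteq> {}\<close>, where K = K and S = S and L = L] S assms(4)
    unfolding q_def by auto
  have "real (card X) * (1 - q) ^ L \<le> real (card X) * exp (- q) ^ L"
    using exp_ge_add_one_self[of "- q"] q1 by (intro mult_left_mono power_mono) auto
  also have "\<dots> = exp (ln (real (card X)) - q * real L)"
    using X by (simp add: exp_diff exp_minus exp_of_nat_mult[symmetric] field_simps)
  also have "\<dots> < 1"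
    using La(1) q by (simp add: a_def field_simps)
  finally have "card {x\<in>X. S x \<inter> F = {}} = 0" using F(3) by linarith
  then have "{x\<in>X. S x \<inter> F = {}} = {}" using assms(1) by simp
  then have "\<forall>x\<in>X. S x \<inter> F \<noteq> {}" by blast
  moreover have "real (card F) \<le> ln (real (card X)) * (real (card C) / K) + 1"
    using F(2) La(2) by (simp add: a_def q_def)
  ultimately show ?thesis using F(1) by blast
qed

text \<open>Powers of a base above 1 outgrow every linear function. This is what absorbs the loss
  from rounding.\<close>

lemma le_one_if_powers_le_linear:
  fixes a M :: real
  assumes "\<And>k. k \<ge> 1 \<Longrightarrow> a ^ k \<le> M * real k"
  shows "a \<le> 1"
proof (rule ccontr)
  assume "\<not> a \<le> 1"
  then have a: "a > 1" by simp
  then have M: "M > 0" using assms[of 1] by simp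
  have "(\<lambda>n. real n * (1 / a) ^ n) \<longlonglongrightarrow> 0"
    using a by (intro powser_times_n_limit_0) auto
  then have "\<forall>\<^sub>F n in sequentially. real n * (1 / a) ^ n < 1 / M"
    using M by (intro order_tendstoD(2)) auto
  then have "\<forall>\<^sub>F n in sequentially. real n * (1 / a) ^ n < 1 / M \<and> n \<ge> 1"
    by (intro eventually_conj eventually_ge_at_top)
  then obtain n where "real n * (1 / a) ^ n < 1 / M" "n \<ge> 1"
    by (auto simp: eventually_sequentially)
  then show False
    using assms[of n] a M by (simp add: field_simps power_divide)
qed

text \<open>A fractional colouring with ratio \<open>card C / K\<close> gives one of the \<open>k\<close>-block messages with ratio
  \<open>(card C / K) ^ k\<close>. Rounding it to a proper colouring by a greedy covering costs a factor
  linear in \<open>k\<close>, which disappears in the rate as \<open>k\<close> grows.\<close>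

lemma fractional_colouring_bound:
  fixes S :: "('a \<Rightarrow> bool list) \<Rightarrow> 'c set"
  assumes "finite (verts D)" "t \<ge> 1" "finite C" "K > 0"
    and S: "\<And>x. x \<in> msgs t (verts D) \<Longrightarrow> S x \<subseteq> C"
      "\<And>x. x \<in> msgs t (verts D) \<Longrightarrow> K \<le> real (card (S x))"
    and disj: "\<And>x y. x \<in> msgs t (verts D) \<Longrightarrow> y \<in> msgs t (verts D) \<Longrightarrow> confusable D x y
      \<Longrightarrow> S x \<inter> S y = {}"
  shows "2 powr (real t * \<beta> D) * K \<le> real (card C)"
proof -
  let ?V = "verts D"
  define n where "n = card ?V"
  define u where "u = real (card C) / K"
  obtain x0 where x0: "x0 \<in> msgs t ?V" using msgs_nonempty by blast
  have "K \<le> real (card C)"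
    using S(2)[OF x0] card_mono[OF assms(3) S(1)[OF x0]] by simp
  then have u: "u \<ge> 1" using assms(4) by (simp add: u_def)
  \<comment> \<open>The factor 2 pays for rounding the number of colours up to a power of two; the
    rest comes from the logarithm of the number of messages and the additive 1 of the greedy
    bound.\<close>
  have "(2 powr (real t * \<beta> D) / u) ^ k \<le> (2 * (real (t * n) + 1)) * real k" if k: "k \<ge> 1" for k
  proof -
    define X where "X = msgs (k * t) ?V"
    \<comment> \<open>The \<open>k\<close>-fold product of the fractional colouring, taken
      blockwise.\<close>
    define T where "T x = (\<Pi>\<^sub>E i\<in>{..<k}. S (block ?V t x i))" for x
    have finX: "finite X" "X \<noteq> {}" using assms(1) by (auto simp: X_def finite_msgs msgs_nonempty)
    have blk: "block ?V t x i \<in> msgs t ?V" if "x \<in> X" "i < k" for x i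
      using that by (auto simp: X_def intro: block_in_msgs)
    have T1: "T x \<subseteq> (\<Pi>\<^sub>E i\<in>{..<k}. C)" if "x \<in> X" for x
      unfolding T_def using S(1) blk[OF that] by (intro PiE_mono) auto
    have T2: "K ^ k \<le> real (card (T x))" if "x \<in> X" for x
    proof -
      have "K ^ k = (\<Prod>i<k. K)" by simp
      also have "\<dots> \<le> (\<Prod>i<k. real (card (S (block ?V t x i))))"
        using S(2) blk[OF that] assms(4) by (intro prod_mono) auto
      finally show ?thesis by (simp add: T_def card_PiE)
    qed
    have fC: "finite (\<Pi>\<^sub>E i\<in>{..<k}. C)" using assms(3) by (intro finite_PiE) auto
    have "\<exists>F\<subseteq>(\<Pi>\<^sub>E i\<in>{..<k}. C). (\<forall>x\<in>X. T x \<inter> F \<noteq> {}) \<and>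
      real (card F) \<le> ln (real (card X)) * (real (card (\<Pi>\<^sub>E i\<in>{..<k}. C)) / K ^ k) + 1"
    proof (rule ex_small_hitting_set[OF finX fC])
      show "K ^ k > 0" using assms(4) by simp
    qed (use T1 T2 in auto)
    then obtain F where F: "F \<subseteq> (\<Pi>\<^sub>E i\<in>{..<k}. C)" "\<forall>x\<in>X. T x \<inter> F \<noteq> {}"
      "real (card F) \<le> ln (real (card X)) * (real (card (\<Pi>\<^sub>E i\<in>{..<k}. C)) / K ^ k) + 1"
      by blast
    have "ln (real (card X)) = real (k * t * n) * ln 2"
      using assms(1) by (simp add: X_def card_msgs ln_realpow n_def)
    also have "\<dots> \<le> real (k * t * n)"
      using ln_2_less_1 by (intro mult_left_le) auto
    finally have lnX: "ln (real (card X)) \<le> real (k * t * n)" .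
    have "real (card (\<Pi>\<^sub>E i\<in>{..<k}. C)) / K ^ k = u ^ k"
      by (simp add: card_PiE u_def power_divide)
    then have "real (card F) \<le> ln (real (card X)) * u ^ k + 1" using F(3) by simp
    also have "\<dots> \<le> real (k * t * n) * u ^ k + 1"
      using u by (intro add_mono mult_right_mono lnX) auto
    also have "\<dots> \<le> real (k * t * n) * u ^ k + real k * u ^ k"
      using mult_mono[of 1 "real k" 1 "u ^ k"] k u by simp
    finally have cF: "real (card F) \<le> (real (t * n) + 1) * real k * u ^ k"
      by (simp add: algebra_simps)
    \<comment> \<open>Any point of the hitting set inside \<open>T x\<close> may be the colour of
      \<open>x\<close>: confusable messages have disjoint \<open>T\<close> because some block has
      disjoint \<open>S\<close>.\<close>
    define c where "c x = (SOME w. w \<in> T x \<inter> F)" for x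
    have c: "c x \<in> T x \<inter> F" if "x \<in> X" for x
      unfolding c_def using F(2) that by (intro someI_ex[of "\<lambda>w. w \<in> T x \<inter> F"]) blast
    have proper: "proper_colouring D (k * t) c"
      unfolding proper_colouring_def X_def[symmetric]
    proof (intro ballI impI)
      fix x y assume xy: "x \<in> X" "y \<in> X" "confusable D x y"
      then obtain i where i: "i < k" "confusable D (block ?V t x i) (block ?V t y i)"
        using confusable_block unfolding X_def by metis
      then have "S (block ?V t x i) \<inter> S (block ?V t y i) = {}" using disj blk xy by blast
      moreover have "c x i \<in> S (block ?V t x i)" "c y i \<in> S (block ?V t y i)"
        using c[OF xy(1)] c[OF xy(2)] i(1) by (auto simp: T_def PiE_iff)
      ultimately show "c x \<noteq> c y" by auto
    qed
    have finF: "finite F" using F(1) fC finite_subset by blast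
    have F0: "card F > 0" using finX(2) c finF by (fastforce simp: card_gt_0_iff)
    obtain p where p: "card F \<le> 2 ^ p" "2 ^ p \<le> 2 * card F"
    proof -
      define p where "p = (LEAST p. card F \<le> 2 ^ p)"
      have le: "card F \<le> 2 ^ p" unfolding p_def by (rule LeastI[of _ "card F"]) (simp add: less_imp_le)
      moreover have "2 ^ p \<le> 2 * card F"
      proof (cases p)
        case 0
        then show ?thesis using F0 by simp
      next
        case (Suc m)
        then have "\<not> card F \<le> 2 ^ m" using not_less_Least[of m "\<lambda>p. card F \<le> 2 ^ p"] by (simp add: p_def)
        then show ?thesis using Suc by simp
      qed
      ultimately show ?thesis using that by blast
    qed
    have "card (c ` X) \<le> card F" using c by (intro card_mono finF) auto
    then have "card (c ` msgs (k * t) ?V) \<le> 2 ^ p" using p(1) by (simp add: X_def)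
    then have "\<beta>\<^bsub>k * t\<^esub> D \<le> real p / real (k * t)"
      using broadcast_rate_t_le[OF assms(1) proper] by blast
    moreover have "\<beta> D \<le> \<beta>\<^bsub>k * t\<^esub> D" using k assms(2) by (intro broadcast_rate_le) simp
    ultimately have "\<beta> D \<le> real p / real (k * t)" by simp
    then have "real (k * t) * \<beta> D \<le> real p" using k assms(2) by (simp add: field_simps)
    then have "2 powr (real (k * t) * \<beta> D) \<le> 2 powr real p" by simp
    also have "\<dots> = real (2 ^ p)" by (simp add: powr_realpow)
    also have "\<dots> \<le> 2 * real (card F)" using p(2) by (metis of_nat_le_iff of_nat_mult of_nat_numeral)
    also have "\<dots> \<le> 2 * (real (t * n) + 1) * real k * u ^ k" using cF by (simp only: mult.assoc)
    finally have "(2 powr (real t * \<beta> D)) ^ k \<le> 2 * (real (t * n) + 1) * real k * u ^ k"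
      by (simp add: powr_realpow[symmetric] powr_powr mult_ac)
    then show ?thesis using u by (simp add: power_divide field_simps)
  qed
  then have "2 powr (real t * \<beta> D) / u \<le> 1" by (rule le_one_if_powers_le_linear)
  then show ?thesis using u assms(4) by (simp add: u_def field_simps)
qed

text \<open>A proper colouring is a fractional one with singleton sets and
  \<open>K = 1\<close>.\<close>

corollary colouring_bound:
  assumes "finite (verts D)" "t \<ge> 1" "proper_colouring D t c"
  shows "2 powr (real t * \<beta> D) \<le> real (card (c ` msgs t (verts D)))"
proof -
  have "2 powr (real t * \<beta> D) * 1 \<le> real (card (c ` msgs t (verts D)))"
    using assms(3) finite_msgs[OF assms(1)]
    by (intro fractional_colouring_bound[OF assms(1,2), where S = "\<lambda>x. {c x}"])
      (auto simp: proper_colouring_def)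
  then show ?thesis by simp
qed

subsection \<open>Rates of disjoint parts\<close>

definition extend :: "'a set \<Rightarrow> 'a set \<Rightarrow> ('a \<Rightarrow> bool list) \<Rightarrow> ('a \<Rightarrow> bool list) \<Rightarrow> 'a \<Rightarrow> bool list"
  where "extend V A z x = (\<lambda>j\<in>V. if j \<in> A then x j else z j)"

lemma extend_in_msgs:
  "x \<in> msgs t A \<Longrightarrow> z \<in> msgs t V \<Longrightarrow> extend V A z x \<in> msgs t V"
  by (auto simp: extend_def msgs_def PiE_iff)

text \<open>The backgrounds \<open>z\<close> and \<open>w\<close> need to agree only on side
  information that leaves \<open>A\<close>; elsewhere they may differ. This freedom is essential
  when the messages of a part unknown to \<open>A\<close> vary.\<close>

lemma extend_confusable:
  assumes "A \<subseteq> verts D" "confusable (D \<restriction> A) x y"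
    "\<And>r j. r \<in> A \<Longrightarrow> j \<in> out_nbrs D r \<Longrightarrow> j \<notin> A \<Longrightarrow> z j = w j"
  shows "confusable D (extend (verts D) A z x) (extend (verts D) A w y)"
proof -
  obtain r where r: "r \<in> A" "x r \<noteq> y r" "\<forall>j\<in>out_nbrs D r \<inter> A. x j = y j"
    using assms(2) by (auto simp: confusable_def out_nbrs_induce)
  then show ?thesis
    using assms(1,3) by (auto simp: confusable_def extend_def)
qed

text \<open>Receivers in \<open>A\<close> know nothing about \<open>B\<close>, so the codewords compatible with \<open>x\<close> on \<open>A\<close>,
  as the messages on \<open>B\<close> vary, form a fractional colouring for \<open>A\<close>.\<close>

lemma broadcast_rate_add_le:
  assumes "finite (verts D)" "A \<subseteq> verts D" "B \<subseteq> verts D" "A \<inter> B = {}" "t \<ge> 1"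
    and no_arc: "\<And>u v. u \<in> A \<Longrightarrow> v \<in> B \<Longrightarrow> \<not> u \<rightarrow>\<^bsub>D\<^esub> v"
    and z: "z \<in> msgs t (verts D)"
    and proper: "proper_colouring D t c"
    and C: "\<And>x. x \<in> msgs t (verts D) \<Longrightarrow> (\<And>j. j \<in> verts D - A - B \<Longrightarrow> x j = z j) \<Longrightarrow> c x \<in> C"
    and card_C: "finite C" "card C \<le> 2 ^ p"
  shows "real t * (\<beta> (D \<restriction> A) + \<beta> (D \<restriction> B)) \<le> real p"
proof -
  have A: "finite (verts (D \<restriction> A))" and B: "finite (verts (D \<restriction> B))"
    using assms(1-3) by (auto intro: finite_subset)
  let ?V = "verts D"
  define e where "e x y = extend ?V A (extend ?V B z y) x" for x y
  have e: "e x y \<in> msgs t ?V" if "x \<in> msgs t A" "y \<in> msgs t B" for x y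
    using that z by (simp add: e_def extend_in_msgs)
  define S where "S x = (\<lambda>y. c (e x y)) ` msgs t B" for x
  have properB: "proper_colouring (D \<restriction> B) t (\<lambda>y. c (e x y))" if x: "x \<in> msgs t A" for x
    unfolding proper_colouring_def
  proof (intro ballI impI)
    fix y y' assume y: "y \<in> msgs t (verts (D \<restriction> B))" "y' \<in> msgs t (verts (D \<restriction> B))"
      "confusable (D \<restriction> B) y y'"
    \<comment> \<open>Disjointness allows the two extensions to be swapped, so that \<open>x\<close>
      becomes part of a common background.\<close>
    have "e x y = extend ?V B (extend ?V A z x) y" for y
      using assms(4) by (auto simp: e_def extend_def fun_eq_iff)
    then have "confusable D (e x y) (e x y')"
      using extend_confusable[OF assms(3) y(3)] by simp
    then show "c (e x y) \<noteq> c (e x y')"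
      using proper e x y(1,2) by (simp add: proper_colouring_def)
  qed
  \<comment> \<open>Here \<open>K\<close> is the lower bound, from \<open>colouring_bound\<close>
    for \<open>B\<close>, on the number of codewords compatible with a fixed
    \<open>x\<close>.\<close>
  have "2 powr (real t * \<beta> (D \<restriction> A)) * 2 powr (real t * \<beta> (D \<restriction> B)) \<le> real (card C)"
  proof (rule fractional_colouring_bound[OF A assms(5) card_C(1), where S = S])
    fix x assume x: "x \<in> msgs t (verts (D \<restriction> A))"
    show "S x \<subseteq> C"
      unfolding S_def using x e by (auto intro!: C simp: e_def extend_def)
    show "2 powr (real t * \<beta> (D \<restriction> B)) \<le> real (card (S x))"
      using colouring_bound[OF B assms(5) properB] x by (simp add: S_def)
  next
    fix x x' assume x: "x \<in> msgs t (verts (D \<restriction> A))" "x' \<in> msgs t (verts (D \<restriction> A))"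
      "confusable (D \<restriction> A) x x'"
    have "c (e x y) \<noteq> c (e x' y')" if y: "y \<in> msgs t B" "y' \<in> msgs t B" for y y'
    proof -
      \<comment> \<open>The backgrounds differ only on \<open>B\<close>, which no receiver in
        \<open>A\<close> sees.\<close>
      have "confusable D (e x y) (e x' y')"
        unfolding e_def using no_arc
        by (intro extend_confusable[OF assms(2) x(3)])
          (auto simp: extend_def out_nbrs_def restrict_def)
      then show ?thesis using proper e x(1,2) y by (simp add: proper_colouring_def)
    qed
    then show "S x \<inter> S x' = {}" by (auto simp: S_def)
  qed simp
  also have "\<dots> \<le> 2 powr real p" using card_C(2) by (simp add: powr_realpow flip: of_nat_le_iff)
  finally show ?thesis by (simp add: distrib_left flip: powr_add)
qed

subsection \<open>Two senders\<close>

definition bitwise_xor :: "bool list \<Rightarrow> bool list \<Rightarrow> bool list" where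
  "bitwise_xor = map2 (\<noteq>)"

lemma bitwise_xor_in_bits: "v \<in> bits n \<Longrightarrow> w \<in> bits n \<Longrightarrow> bitwise_xor v w \<in> bits n"
  by (simp add: bitwise_xor_def bits_def)

lemma bitwise_xor_left_cancel:
  assumes "u \<in> bits n" "v \<in> bits n" "w \<in> bits n"
  shows "bitwise_xor u v = bitwise_xor u w \<longleftrightarrow> v = w"
  using assms by (auto simp: bitwise_xor_def bits_def list_eq_iff_nth_eq)

lemma bitwise_xor_right_cancel:
  assumes "u \<in> bits n" "v \<in> bits n" "w \<in> bits n"
  shows "bitwise_xor v u = bitwise_xor w u \<longleftrightarrow> v = w"
  using assms by (auto simp: bitwise_xor_def bits_def list_eq_iff_nth_eq)

lemma restrict_confusable:
  assumes "r \<in> P" "x r \<noteq> y r" "\<And>j. j \<in> out_nbrs D r \<Longrightarrow> x j = y j"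
  shows "confusable (D \<restriction> P) (restrict x P) (restrict y P)"
  using assms by (auto simp: confusable_def out_nbrs_induce)

text \<open>Pads a code so that the two summands of the xor have equal length, without which
  cancellation could fail.\<close>

lemma index_code_mono:
  assumes "finite (verts D)" "c \<in> msgs t (verts D) \<rightarrow> bits p" "proper_colouring D t c" "p \<le> q"
  obtains d where "d \<in> msgs t (verts D) \<rightarrow> bits q" "proper_colouring D t d"
proof -
  have "card (c ` msgs t (verts D)) \<le> card (bits p)"
    using assms(2) by (intro card_mono finite_bits) auto
  also have "\<dots> \<le> 2 ^ q" using assms(4) by (simp add: card_bits)
  finally have "\<exists>enc dec. index_code D t q enc dec"
    using ex_index_code_of_colouring assms by blast
  then show ?thesis unfolding ex_index_code_iff using that by blast
qed

section \<open>Upper bound for the two-sender rate\<close>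

text \<open>A confused receiver in \<open>M1 - M2\<close> or \<open>M1 \<inter> M2\<close> sees the
  same summand of the other part in both xors, so these differ because its own summands do. A
  receiver in \<open>M2 - M1\<close> relies on the second sub-codeword.\<close>

lemma two_sender_achievability:
  assumes V: "M1 \<union> M2 = verts D"
    and full: "\<And>u v. u \<in> M1 - M2 \<Longrightarrow> v \<in> M1 \<inter> M2 \<Longrightarrow> u \<rightarrow>\<^bsub>D\<^esub> v \<and> v \<rightarrow>\<^bsub>D\<^esub> u"
    and c1: "c1 \<in> msgs t (M1 - M2) \<rightarrow> bits p" "proper_colouring (D \<restriction> (M1 - M2)) t c1"
    and c2: "c2 \<in> msgs t (M2 - M1) \<rightarrow> bits p2" "proper_colouring (D \<restriction> (M2 - M1)) t c2"
    and c3: "c3 \<in> msgs t (M1 \<inter> M2) \<rightarrow> bits p" "proper_colouring (D \<restriction> (M1 \<inter> M2)) t c3"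
  shows "\<exists>enc1 enc2 dec. two_sender_index_code D M1 M2 t p p2 enc1 enc2 dec"
proof -
  have M: "M1 \<subseteq> verts D" "M2 \<subseteq> verts D" using V by auto
  define e1 where "e1 x = bitwise_xor (c1 (restrict x (M1 - M2))) (c3 (restrict x (M1 \<inter> M2)))" for x
  define e2 where "e2 x = c2 (restrict x (M2 - M1))" for x
  have e1: "e1 (restrict x M1) = bitwise_xor (c1 (restrict x (M1 - M2))) (c3 (restrict x (M1 \<inter> M2)))" for x
    by (simp add: e1_def Int_absorb1 Diff_subset Int_lower1 inf.absorb2)
  have e2: "e2 (restrict x M2) = c2 (restrict x (M2 - M1))" for x
    by (simp add: e2_def Int_absorb1 Diff_subset)
  have b1: "c1 (restrict x (M1 - M2)) \<in> bits p" "c3 (restrict x (M1 \<inter> M2)) \<in> bits p"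
    if "x \<in> msgs t M1" for x
    using c1(1) c3(1) restrict_in_msgs[OF that, of "M1 - M2"] restrict_in_msgs[OF that, of "M1 \<inter> M2"]
    by auto
  have "e1 \<in> msgs t M1 \<rightarrow> bits p" by (auto simp: e1_def intro!: bitwise_xor_in_bits b1)
  moreover have "e2 \<in> msgs t M2 \<rightarrow> bits p2"
    using c2(1) restrict_in_msgs[of _ t M2 "M2 - M1"] by (auto simp: e2_def)
  moreover have "proper_colouring D t (\<lambda>x. (e1 (restrict x M1), e2 (restrict x M2)))"
    unfolding proper_colouring_def
  proof (intro ballI impI)
    fix x y assume x: "x \<in> msgs t (verts D)" and y: "y \<in> msgs t (verts D)" and xy: "confusable D x y"
    obtain r where r: "r \<in> verts D" "x r \<noteq> y r" "\<And>j. j \<in> out_nbrs D r \<Longrightarrow> x j = y j"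
      using xy by (auto simp: confusable_def)
    have sub: "restrict x P \<in> msgs t P" "restrict y P \<in> msgs t P" if "P \<subseteq> verts D" for P
      using restrict_in_msgs[OF x that] restrict_in_msgs[OF y that] .
    have sub3: "M1 - M2 \<subseteq> verts D" "M2 - M1 \<subseteq> verts D" "M1 \<inter> M2 \<subseteq> verts D" using V by auto
    have b: "c1 (restrict z (M1 - M2)) \<in> bits p" "c3 (restrict z (M1 \<inter> M2)) \<in> bits p"
      if "z \<in> msgs t (verts D)" for z
      using c1(1) c3(1) restrict_in_msgs[OF that sub3(1)] restrict_in_msgs[OF that sub3(3)] by auto
    \<comment> \<open>Confusion at \<open>r\<close> in \<open>D\<close> persists in the part
      containing \<open>r\<close>, whatever arcs leave that part.\<close>
    have neq: "c (restrict x P) \<noteq> c (restrict y P)"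
      if "r \<in> P" "P \<subseteq> verts D" "proper_colouring (D \<restriction> P) t c" for P and c :: "_ \<Rightarrow> bool list"
    proof -
      have "confusable (D \<restriction> P) (restrict x P) (restrict y P)"
        using that(1) r(2,3) by (rule restrict_confusable)
      then show ?thesis using that(2,3) sub by (simp add: proper_colouring_def)
    qed
    consider "r \<in> M1 - M2" | "r \<in> M2 - M1" | "r \<in> M1 \<inter> M2" using r(1) V by blast
    then show "(e1 (restrict x M1), e2 (restrict x M2)) \<noteq> (e1 (restrict y M1), e2 (restrict y M2))"
    proof cases
      case 1
      then have "restrict x (M1 \<inter> M2) = restrict y (M1 \<inter> M2)"
        using full r(3) by (auto simp: restrict_eq_iff out_nbrs_def)
      moreover have "c1 (restrict x (M1 - M2)) \<noteq> c1 (restrict y (M1 - M2))"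
        using neq[OF 1 sub3(1) c1(2)] .
      ultimately show ?thesis using b x y by (simp add: e1 bitwise_xor_right_cancel[of _ p])
    next
      case 2
      then show ?thesis using neq[OF 2 sub3(2) c2(2)] by (simp add: e2)
    next
      case 3
      then have "restrict x (M1 - M2) = restrict y (M1 - M2)"
        using full r(3) by (auto simp: restrict_eq_iff out_nbrs_def)
      moreover have "c3 (restrict x (M1 \<inter> M2)) \<noteq> c3 (restrict y (M1 \<inter> M2))"
        using neq[OF 3 sub3(3) c3(2)] .
      ultimately show ?thesis using b x y by (simp add: e1 bitwise_xor_left_cancel[of _ p])
    qed
  qed
  ultimately show ?thesis unfolding ex_two_sender_index_code_iff[OF M] by blast
qed

lemma two_sender_rate_t_attained:
  assumes "\<exists>p1 p2 enc1 enc2 dec. two_sender_index_code D M1 M2 t p1 p2 enc1 enc2 dec"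
  obtains p1 p2 enc1 enc2 dec where "two_sender_rate_t t D M1 M2 = real (p1 + p2) / real t"
    "two_sender_index_code D M1 M2 t p1 p2 enc1 enc2 dec"
proof -
  let ?P = "\<lambda>p. \<exists>p1 p2 enc1 enc2 dec.
       p = p1 + p2 \<and> two_sender_index_code D M1 M2 t p1 p2 enc1 enc2 dec"
  have "?P (LEAST p. ?P p)" using assms by (intro LeastI_ex[of ?P]) blast
  then obtain p1 p2 enc1 enc2 dec where p: "(LEAST p. ?P p) = p1 + p2"
    and code: "two_sender_index_code D M1 M2 t p1 p2 enc1 enc2 dec" by blast
  show ?thesis by (rule that[OF _ code]) (simp only: two_sender_rate_t_def p)
qed

lemma two_sender_rate_t_le:
  assumes "\<exists>enc1 enc2 dec. two_sender_index_code D M1 M2 t p1 p2 enc1 enc2 dec"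
  shows "two_sender_rate_t t D M1 M2 \<le> real (p1 + p2) / real t"
  unfolding two_sender_rate_t_def
  by (intro divide_right_mono of_nat_mono Least_le) (use assms in blast, simp)

lemma two_sender_rate_le: "t \<ge> 1 \<Longrightarrow> two_sender_rate D M1 M2 \<le> two_sender_rate_t t D M1 M2"
  unfolding two_sender_rate_def
  by (intro cINF_lower bdd_belowI[of _ 0]) (auto simp: two_sender_rate_t_def)

text \<open>The existence claim is recorded separately because the lower bound needs the minimum in
  the rate to be attained.\<close>

lemma two_sender_rate_t_upper:
  assumes fin: "finite (verts D)" and V: "M1 \<union> M2 = verts D" and t: "t \<ge> 1"
    and full: "\<And>u v. u \<in> M1 - M2 \<Longrightarrow> v \<in> M1 \<inter> M2 \<Longrightarrow> u \<rightarrow>\<^bsub>D\<^esub> v \<and> v \<rightarrow>\<^bsub>D\<^esub> u"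
  shows "\<exists>p1 p2 enc1 enc2 dec. two_sender_index_code D M1 M2 t p1 p2 enc1 enc2 dec"
    and "two_sender_rate_t t D M1 M2 \<le>
      \<beta>\<^bsub>t\<^esub> (D \<restriction> (M2 - M1)) + max (\<beta>\<^bsub>t\<^esub> (D \<restriction> (M1 - M2))) (\<beta>\<^bsub>t\<^esub> (D \<restriction> (M1 \<inter> M2)))"
proof -
  have f1: "finite (verts (D \<restriction> (M1 - M2)))" and f2: "finite (verts (D \<restriction> (M2 - M1)))"
    and f3: "finite (verts (D \<restriction> (M1 \<inter> M2)))"
    using finite_subset[OF _ fin] V by auto
  obtain p1 c1 where c1: "\<beta>\<^bsub>t\<^esub> (D \<restriction> (M1 - M2)) = real p1 / real t"
    "c1 \<in> msgs t (verts (D \<restriction> (M1 - M2))) \<rightarrow> bits p1" "proper_colouring (D \<restriction> (M1 - M2)) t c1"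
    using broadcast_rate_t_attained[OF f1 t] by metis
  obtain p2 c2 where c2: "\<beta>\<^bsub>t\<^esub> (D \<restriction> (M2 - M1)) = real p2 / real t"
    "c2 \<in> msgs t (verts (D \<restriction> (M2 - M1))) \<rightarrow> bits p2" "proper_colouring (D \<restriction> (M2 - M1)) t c2"
    using broadcast_rate_t_attained[OF f2 t] by metis
  obtain p3 c3 where c3: "\<beta>\<^bsub>t\<^esub> (D \<restriction> (M1 \<inter> M2)) = real p3 / real t"
    "c3 \<in> msgs t (verts (D \<restriction> (M1 \<inter> M2))) \<rightarrow> bits p3" "proper_colouring (D \<restriction> (M1 \<inter> M2)) t c3"
    using broadcast_rate_t_attained[OF f3 t] by metis
  let ?p = "max p1 p3"
  obtain d1 where d1: "d1 \<in> msgs t (verts (D \<restriction> (M1 - M2))) \<rightarrow> bits ?p"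
    "proper_colouring (D \<restriction> (M1 - M2)) t d1"
    using index_code_mono[OF f1 c1(2,3), of ?p] by auto
  obtain d3 where d3: "d3 \<in> msgs t (verts (D \<restriction> (M1 \<inter> M2))) \<rightarrow> bits ?p"
    "proper_colouring (D \<restriction> (M1 \<inter> M2)) t d3"
    using index_code_mono[OF f3 c3(2,3), of ?p] by auto
  have code: "\<exists>enc1 enc2 dec. two_sender_index_code D M1 M2 t ?p p2 enc1 enc2 dec"
    using two_sender_achievability[OF V full _ d1(2) _ c2(3) _ d3(2)] d1(1) c2(2) d3(1) by simp
  then show "\<exists>p1 p2 enc1 enc2 dec. two_sender_index_code D M1 M2 t p1 p2 enc1 enc2 dec" by blast
  have "real (max p1 p3 + p2) / real t = real p2 / real t + max (real p1 / real t) (real p3 / real t)"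
    using t by (auto simp: max_def field_simps divide_le_cancel)
  then show "two_sender_rate_t t D M1 M2 \<le>
      \<beta>\<^bsub>t\<^esub> (D \<restriction> (M2 - M1)) + max (\<beta>\<^bsub>t\<^esub> (D \<restriction> (M1 - M2))) (\<beta>\<^bsub>t\<^esub> (D \<restriction> (M1 \<inter> M2)))"
    using two_sender_rate_t_le[OF code] by (simp only: c1(1) c2(1) c3(1))
qed

text \<open>Near-optimal codes for the three parts may use different message lengths; at the product
  of these lengths all three rates are still near-optimal. The sum and the maximum contribute half
  of the error each.\<close>

lemma two_sender_rate_upper:
  assumes fin: "finite (verts D)" and V: "M1 \<union> M2 = verts D"
    and full: "\<And>u v. u \<in> M1 - M2 \<Longrightarrow> v \<in> M1 \<inter> M2 \<Longrightarrow> u \<rightarrow>\<^bsub>D\<^esub> v \<and> v \<rightarrow>\<^bsub>D\<^esub> u"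
  shows "two_sender_rate D M1 M2 \<le>
    \<beta> (D \<restriction> (M2 - M1)) + max (\<beta> (D \<restriction> (M1 - M2))) (\<beta> (D \<restriction> (M1 \<inter> M2)))"
proof (rule field_le_epsilon)
  fix e :: real assume "e > 0"
  then have e: "e / 2 > 0" by simp
  let ?D1 = "D \<restriction> (M1 - M2)" and ?D2 = "D \<restriction> (M2 - M1)" and ?D3 = "D \<restriction> (M1 \<inter> M2)"
  obtain t1 where t1: "t1 \<ge> 1" "\<beta>\<^bsub>t1\<^esub> ?D1 < \<beta> ?D1 + e / 2" using broadcast_rate_approx[OF e] .
  obtain t2 where t2: "t2 \<ge> 1" "\<beta>\<^bsub>t2\<^esub> ?D2 < \<beta> ?D2 + e / 2" using broadcast_rate_approx[OF e] .
  obtain t3 where t3: "t3 \<ge> 1" "\<beta>\<^bsub>t3\<^esub> ?D3 < \<beta> ?D3 + e / 2" using broadcast_rate_approx[OF e] .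
  define t where "t = t1 * t2 * t3"
  have t: "t \<ge> 1" using t1 t2 t3 by (simp add: t_def)
  have "finite (verts ?D1)" "finite (verts ?D2)" "finite (verts ?D3)"
    using finite_subset[OF _ fin] V by auto
  then have "\<beta>\<^bsub>(t2 * t3) * t1\<^esub> ?D1 \<le> \<beta>\<^bsub>t1\<^esub> ?D1" "\<beta>\<^bsub>(t1 * t3) * t2\<^esub> ?D2 \<le> \<beta>\<^bsub>t2\<^esub> ?D2"
    "\<beta>\<^bsub>(t1 * t2) * t3\<^esub> ?D3 \<le> \<beta>\<^bsub>t3\<^esub> ?D3"
    using t1(1) t2(1) t3(1) by (intro broadcast_rate_t_mult_le; simp)+
  then have "\<beta>\<^bsub>t\<^esub> ?D1 \<le> \<beta> ?D1 + e / 2" "\<beta>\<^bsub>t\<^esub> ?D2 \<le> \<beta> ?D2 + e / 2" "\<beta>\<^bsub>t\<^esub> ?D3 \<le> \<beta> ?D3 + e / 2"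
    using t1(2) t2(2) t3(2) by (simp_all add: t_def mult_ac)
  then have "\<beta>\<^bsub>t\<^esub> ?D2 + max (\<beta>\<^bsub>t\<^esub> ?D1) (\<beta>\<^bsub>t\<^esub> ?D3) \<le> \<beta> ?D2 + max (\<beta> ?D1) (\<beta> ?D3) + e"
    by (auto simp: max_def)
  then show "two_sender_rate D M1 M2 \<le> \<beta> ?D2 + max (\<beta> ?D1) (\<beta> ?D3) + e"
    using two_sender_rate_le[OF t, of D M1 M2] two_sender_rate_t_upper(2)[OF fin V t full] by linarith
qed

section \<open>Lower bound for the two-sender rate\<close>

text \<open>Fixing all messages outside \<open>M1 - M2\<close> makes the other sub-codeword constant, so the
  sub-codeword of sender 1 is an index code for \<open>D \<restriction> (M1 - M2)\<close> by itself.\<close>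

lemma private_colouring_bound:
  assumes fin: "finite (verts D)" and V: "M1 \<union> M2 = verts D" and t: "t \<ge> 1"
    and z: "z \<in> msgs t (verts D)"
    and c1: "c1 \<in> msgs t M1 \<rightarrow> bits p1"
    and proper: "proper_colouring D t (\<lambda>x. (c1 (restrict x M1), c2 (restrict x M2)))"
  shows "real t * \<beta> (D \<restriction> (M1 - M2)) \<le> real p1"
proof -
  let ?P = "M1 - M2"
  let ?e = "extend (verts D) ?P z"
  have P: "?P \<subseteq> verts D" "M1 \<subseteq> verts D" using V by auto
  have c1e: "c1 (restrict (?e x) M1) \<in> bits p1" if "x \<in> msgs t ?P" for x
    using c1 restrict_in_msgs[OF extend_in_msgs[OF that z] P(2)] by blast
  have "proper_colouring (D \<restriction> ?P) t (\<lambda>x. c1 (restrict (?e x) M1))"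
    unfolding proper_colouring_def
  proof (intro ballI impI)
    fix x y assume x: "x \<in> msgs t (verts (D \<restriction> ?P))" "y \<in> msgs t (verts (D \<restriction> ?P))"
      "confusable (D \<restriction> ?P) x y"
    \<comment> \<open>Sender 2 sees nothing but the fixed background.\<close>
    have "restrict (?e x) M2 = restrict (?e y) M2"
      by (auto simp: restrict_eq_iff extend_def)
    moreover have "confusable D (?e x) (?e y)"
      by (rule extend_confusable[OF P(1) x(3)]) simp
    then have "(c1 (restrict (?e x) M1), c2 (restrict (?e x) M2)) \<noteq>
        (c1 (restrict (?e y) M1), c2 (restrict (?e y) M2))"
      using proper extend_in_msgs[OF _ z] x(1,2) by (simp add: proper_colouring_def)
    ultimately show "c1 (restrict (?e x) M1) \<noteq> c1 (restrict (?e y) M1)" by simp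
  qed
  then have "\<beta>\<^bsub>t\<^esub> (D \<restriction> ?P) \<le> real p1 / real t"
  proof (rule broadcast_rate_t_le[rotated])
    show "finite (verts (D \<restriction> ?P))" using finite_subset[OF P(1) fin] by simp
    have "(\<lambda>x. c1 (restrict (?e x) M1)) ` msgs t (verts (D \<restriction> ?P)) \<subseteq> bits p1" using c1e by auto
    from card_mono[OF finite_bits this]
    show "card ((\<lambda>x. c1 (restrict (?e x) M1)) ` msgs t (verts (D \<restriction> ?P))) \<le> 2 ^ p1"
      by (simp add: card_bits)
  qed
  then have "\<beta> (D \<restriction> ?P) \<le> real p1 / real t" using broadcast_rate_le[OF t, of "D \<restriction> ?P"] by simp
  then show ?thesis using t by (simp add: field_simps)
qed

text \<open>Each argument of the maximum has its own bound: the one for \<open>M1 - M2\<close> holds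
  sender by sender, the one for \<open>M1 \<inter> M2\<close> for the joint codeword.\<close>

lemma two_sender_code_lower:
  assumes fin: "finite (verts D)" and V: "M1 \<union> M2 = verts D" and t: "t \<ge> 1"
    and no_arc: "(\<forall>u\<in>M2 - M1. \<forall>v\<in>M1 \<inter> M2. \<not> u \<rightarrow>\<^bsub>D\<^esub> v) \<or> (\<forall>u\<in>M1 \<inter> M2. \<forall>v\<in>M2 - M1. \<not> u \<rightarrow>\<^bsub>D\<^esub> v)"
    and code: "two_sender_index_code D M1 M2 t p1 p2 enc1 enc2 dec"
  shows "real t * (\<beta> (D \<restriction> (M2 - M1)) + max (\<beta> (D \<restriction> (M1 - M2))) (\<beta> (D \<restriction> (M1 \<inter> M2)))) \<le> real (p1 + p2)"
proof -
  let ?D1 = "D \<restriction> (M1 - M2)" and ?D2 = "D \<restriction> (M2 - M1)" and ?D3 = "D \<restriction> (M1 \<inter> M2)"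
  have M: "M1 \<subseteq> verts D" "M2 \<subseteq> verts D" using V by auto
  from code obtain c1 c2 where c: "c1 \<in> msgs t M1 \<rightarrow> bits p1" "c2 \<in> msgs t M2 \<rightarrow> bits p2"
    and proper: "proper_colouring D t (\<lambda>x. (c1 (restrict x M1), c2 (restrict x M2)))"
    using ex_two_sender_index_code_iff[OF M] by blast
  obtain z where z: "z \<in> msgs t (verts D)" using msgs_nonempty by blast
  have "real t * \<beta> ?D1 \<le> real p1"
    using private_colouring_bound[OF fin V t z c(1) proper] .
  moreover have "real t * \<beta> ?D2 \<le> real p2"
  proof (rule private_colouring_bound[OF fin _ t z c(2)])
    show "M2 \<union> M1 = verts D" using V by blast
    show "proper_colouring D t (\<lambda>x. (c2 (restrict x M2), c1 (restrict x M1)))"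
      using proper by (auto simp: proper_colouring_def)
  qed
  moreover have "real t * (\<beta> ?D2 + \<beta> ?D3) \<le> real (p1 + p2)"
  proof -
    let ?c = "\<lambda>x. (c1 (restrict x M1), c2 (restrict x M2))"
    have C: "?c x \<in> bits p1 \<times> bits p2" if "x \<in> msgs t (verts D)" for x
      using c restrict_in_msgs[OF that M(1)] restrict_in_msgs[OF that M(2)] by auto
    have card: "finite (bits p1 \<times> bits p2)" "card (bits p1 \<times> bits p2) \<le> 2 ^ (p1 + p2)"
      by (simp_all add: finite_bits card_cartesian_product card_bits power_add)
    have sub: "M2 - M1 \<subseteq> verts D" "M1 \<inter> M2 \<subseteq> verts D" using V by auto
    \<comment> \<open>The direction without arcs decides which part takes the role of
      \<open>A\<close> in \<open>broadcast_rate_add_le\<close>.\<close>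
    show ?thesis using no_arc
    proof
      assume "\<forall>u\<in>M2 - M1. \<forall>v\<in>M1 \<inter> M2. \<not> u \<rightarrow>\<^bsub>D\<^esub> v"
      then show ?thesis
        by (intro broadcast_rate_add_le[OF fin sub _ t _ z proper C card]) auto
    next
      assume "\<forall>u\<in>M1 \<inter> M2. \<forall>v\<in>M2 - M1. \<not> u \<rightarrow>\<^bsub>D\<^esub> v"
      then have "real t * (\<beta> ?D3 + \<beta> ?D2) \<le> real (p1 + p2)"
        by (intro broadcast_rate_add_le[OF fin sub(2,1) _ t _ z proper C card]) auto
      then show ?thesis by (simp add: add.commute)
    qed
  qed
  ultimately show ?thesis by (auto simp: max_def distrib_left)
qed

text \<open>The hypothesis \<open>full\<close> supplies a code for every \<open>t\<close>, so that
  the rate at \<open>t\<close> is realized by an actual code to which the previous bound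
  applies.\<close>

lemma two_sender_rate_lower:
  assumes fin: "finite (verts D)" and V: "M1 \<union> M2 = verts D"
    and full: "\<And>u v. u \<in> M1 - M2 \<Longrightarrow> v \<in> M1 \<inter> M2 \<Longrightarrow> u \<rightarrow>\<^bsub>D\<^esub> v \<and> v \<rightarrow>\<^bsub>D\<^esub> u"
    and no_arc: "(\<forall>u\<in>M2 - M1. \<forall>v\<in>M1 \<inter> M2. \<not> u \<rightarrow>\<^bsub>D\<^esub> v) \<or> (\<forall>u\<in>M1 \<inter> M2. \<forall>v\<in>M2 - M1. \<not> u \<rightarrow>\<^bsub>D\<^esub> v)"
  shows "\<beta> (D \<restriction> (M2 - M1)) + max (\<beta> (D \<restriction> (M1 - M2))) (\<beta> (D \<restriction> (M1 \<inter> M2)))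
    \<le> two_sender_rate D M1 M2"
  unfolding two_sender_rate_def
proof (rule cINF_greatest)
  fix t :: nat assume "t \<in> {1..}"
  then have t: "t \<ge> 1" by simp
  obtain p1 p2 enc1 enc2 dec where "two_sender_rate_t t D M1 M2 = real (p1 + p2) / real t"
    "two_sender_index_code D M1 M2 t p1 p2 enc1 enc2 dec"
    using two_sender_rate_t_attained[OF two_sender_rate_t_upper(1)[OF fin V t full]] by metis
  then show "\<beta> (D \<restriction> (M2 - M1)) + max (\<beta> (D \<restriction> (M1 - M2))) (\<beta> (D \<restriction> (M1 \<inter> M2)))
      \<le> two_sender_rate_t t D M1 M2"
    using two_sender_code_lower[OF fin V t no_arc] t by (simp add: pos_le_divide_eq mult.commute)
qed auto

theorem proposition2:
  fixes D :: "(nat, 'b) pre_digraph" and N :: nat and M1 M2 :: "nat set"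
  assumes "digraph D"
    and "verts D = {1..N}"
    and "M1 \<union> M2 = verts D"
    and "fully_participated D M1 M2"
    and "(1, 3) \<in> parcs (interaction_digraph D M1 M2)"
    and "(3, 1) \<in> parcs (interaction_digraph D M1 M2)"
    and "\<not> ((2, 3) \<in> parcs (interaction_digraph D M1 M2) \<and>
            (3, 2) \<in> parcs (interaction_digraph D M1 M2))"
  shows "two_sender_rate D M1 M2 =
    \<beta> (sub_digraph D M1 M2 2) +
    max (\<beta> (sub_digraph D M1 M2 1)) (\<beta> (sub_digraph D M1 M2 3))"
proof -
  have parts: "sub_digraph D M1 M2 1 = D \<restriction> (M1 - M2)" "sub_digraph D M1 M2 2 = D \<restriction> (M2 - M1)"
    "sub_digraph D M1 M2 3 = D \<restriction> (M1 \<inter> M2)"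
    by (simp_all add: sub_digraph_def msg_part_def)
  have full: "u \<rightarrow>\<^bsub>D\<^esub> v"
    if "(i, j) \<in> parcs (interaction_digraph D M1 M2)"
      "u \<in> verts (sub_digraph D M1 M2 i)" "v \<in> verts (sub_digraph D M1 M2 j)" for i j u v
    using assms(4) that unfolding fully_participated_def by blast
  have full13: "u \<rightarrow>\<^bsub>D\<^esub> v \<and> v \<rightarrow>\<^bsub>D\<^esub> u" if "u \<in> M1 - M2" "v \<in> M1 \<inter> M2" for u v
    using full[OF assms(5)] full[OF assms(6)] that unfolding parts induce_subgraph_verts by blast
  have arc: "(i, j) \<in> parcs (interaction_digraph D M1 M2)"
    if "i \<in> {1, 2, 3}" "j \<in> {1, 2, 3}" "i \<noteq> j" "u \<in> verts (sub_digraph D M1 M2 i)"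
      "v \<in> verts (sub_digraph D M1 M2 j)" "u \<rightarrow>\<^bsub>D\<^esub> v" for i j u v
    using that by (auto simp: interaction_digraph_def)
  \<comment> \<open>A missing arc of the interaction digraph rules out all arcs of \<open>D\<close>
    from the one part to the other.\<close>
  have no_arc: "(\<forall>u\<in>M2 - M1. \<forall>v\<in>M1 \<inter> M2. \<not> u \<rightarrow>\<^bsub>D\<^esub> v) \<or>
      (\<forall>u\<in>M1 \<inter> M2. \<forall>v\<in>M2 - M1. \<not> u \<rightarrow>\<^bsub>D\<^esub> v)"
    using assms(7) arc[of 2 3] arc[of 3 2] unfolding parts induce_subgraph_verts by force
  have fin: "finite (verts D)" by (simp add: assms(2))
  show ?thesis
    unfolding parts
    using two_sender_rate_upper[OF fin assms(3) full13]
      two_sender_rate_lower[OF fin assms(3) full13 no_arc]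
    by (rule order.antisym)
qed

end
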